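(* Let $\Gamma$ be a simple graph of diameter $2$ with order $r$ and size $s$ that has no dominating vertex. Suppose $s=2r-5$. Then there exists a non-zero $(0,1)$-vector in the row space of the adjacency matrix $A(\Gamma)$ over $\mathbb{R}$ which does not occur as a row of $A(\Gamma)$.
   Context: Order is the number of vertices and size the number of edges. A dominating vertex is a vertex adjacent to every other vertex. The adjacency matrix $A(\Gamma)=(a_{ij})$ has $a_{ij}=1$ if $v_i$ is adjacent to $v_j$ and $0$ otherwise; the row space is over the real numbers. *)

theory Defs
  imports "HOL-Analysis.Analysis" "HOL-Library.Extended_Nat"
begin

text \<open>
  A finite simple graph is an adjacency relation on a finite vertex type \<open>'v\<close>; every element
  of \<open>'v\<close> is a vertex, so the order of the graph is \<open>CARD('v)\<close>.
\<close>

definition simple_graph :: "('v \<Rightarrow> 'v \<Rightarrow> bool) \<Rightarrow> bool" where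
  "simple_graph adj \<longleftrightarrow> symp adj \<and> irreflp adj"

definition edges :: "('v \<Rightarrow> 'v \<Rightarrow> bool) \<Rightarrow> 'v set set" where
  "edges adj = {{u, v} | u v. adj u v}"

text \<open>
  \<open>(adj ^^ n) u v\<close> says that there is a walk of length \<open>n\<close> from \<open>u\<close> to \<open>v\<close>. Vertices that are
  not connected have distance \<open>\<infinity>\<close> (infimum of the empty set), so a finite diameter
  implies that the graph is connected.
\<close>

definition graph_dist :: "('v \<Rightarrow> 'v \<Rightarrow> bool) \<Rightarrow> 'v \<Rightarrow> 'v \<Rightarrow> enat" where
  "graph_dist adj u v = (INF n \<in> {n. (adj ^^ n) u v}. enat n)"

definition graph_diameter :: "('v \<Rightarrow> 'v \<Rightarrow> bool) \<Rightarrow> enat" where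
  "graph_diameter adj = (SUP u. SUP v. graph_dist adj u v)"

definition dominating_vertex :: "('v \<Rightarrow> 'v \<Rightarrow> bool) \<Rightarrow> 'v \<Rightarrow> bool" where
  "dominating_vertex adj v \<longleftrightarrow> (\<forall>u. u \<noteq> v \<longrightarrow> adj v u)"

definition adjacency_matrix :: "('v::finite \<Rightarrow> 'v \<Rightarrow> bool) \<Rightarrow> real ^ 'v ^ 'v" where
  "adjacency_matrix adj = (\<chi> i j. if adj i j then 1 else 0)"

end

theory Submission
  imports Defs
begin

text \<open>
  The all-ones vector is never a row of the adjacency matrix, since there are no loops; it is shown
  to lie in the row space. Counting degrees, the minimum degree is 2 or 3. If it is 3, then counting
  the edges around a vertex of degree 3 leaves no slack, which forces the graph to be 3-regular, and
  the rows sum to 3 times the all-ones vector. If it is 2, take a vertex \<open>v\<close> with neighbours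
  \<open>a\<close>, \<open>b\<close>. Degree counting yields another vertex \<open>x\<close> of degree 2, adjacent to (say) \<open>a\<close> and some
  \<open>z \<noteq> b\<close>. The diameter condition provides two edges for each vertex other than \<open>a\<close>, \<open>b\<close>, \<open>z\<close> and one for
  \<open>z\<close>, in total \<open>2r - 5\<close> distinct edges, so these are all the edges. The graph is then a 5-cycle, or
  a triangle with three pendant paths ending in a common vertex, with some vertices
  of degree 2 duplicated, and an explicit combination of rows gives the all-ones vector.
\<close>

section \<open>Degree bounds\<close>

locale diam2_graph =
  fixes adj :: "'v::finite \<Rightarrow> 'v \<Rightarrow> bool"
  assumes sym: "adj u w \<Longrightarrow> adj w u"
    and irr: "\<not> adj u u"
    and diam: "u \<noteq> w \<Longrightarrow> \<not> adj u w \<Longrightarrow> \<exists>t. adj u t \<and> adj t w"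
    and nodom: "\<exists>w. w \<noteq> u \<and> \<not> adj u w"
    and size: "card {(u, w). adj u w} + 10 = 4 * CARD('v)"
begin

definition N :: "'v \<Rightarrow> 'v set" where
  "N u = {w. adj u w}"

lemma in_N [simp]: "w \<in> N u \<longleftrightarrow> adj u w"
  by (simp add: N_def)

lemma adj_commute: "adj u w \<longleftrightarrow> adj w u"
  using sym by blast

lemma sum_deg: "(\<Sum>u\<in>UNIV. card (N u)) + 10 = 4 * CARD('v)"
proof -
  have "{(u, w). adj u w} = (SIGMA u:UNIV. N u)" by auto
  then show ?thesis using size by simp
qed

text \<open>If t were the only neighbour of u, every other vertex would be reached from u through t,
  making t dominating.\<close>

lemma deg_ge_2: "2 \<le> card (N u)"
proof (rule ccontr)
  assume "\<not> 2 \<le> card (N u)"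
  moreover obtain t where t: "adj u t"
    using nodom[of u] diam[of u] by metis
  ultimately have "card (N u) \<le> 1" by simp
  then have N: "w = t" if "adj u w" for w
    using t that card_le_Suc0_iff_eq[of "N u"] by auto
  obtain w where w: "w \<noteq> t" "\<not> adj t w" using nodom by blast
  then have "w \<noteq> u" using t sym by blast
  then show False using diam[of u w] N w by blast
qed

lemma exists_deg_le_3: "\<exists>u. card (N u) \<le> 3"
proof (rule ccontr)
  assume "\<not> ?thesis"
  then have "4 \<le> card (N u)" for u by (simp add: not_le Suc_le_eq[symmetric])
  then have "(\<Sum>u\<in>(UNIV::'v set). 4) \<le> (\<Sum>u\<in>UNIV. card (N u))" by (intro sum_mono)
  then show False using sum_deg by simp
qed

section \<open>Minimum degree 3\<close>

lemma adj_double_count: "(\<Sum>u\<in>S. card (N u)) = (\<Sum>w\<in>UNIV. card (N w \<inter> S))"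
proof -
  have "(\<Sum>u\<in>S. card (N u)) = (\<Sum>u\<in>S. \<Sum>w\<in>UNIV. if adj u w then 1 else 0)"
    by (simp add: sum.If_cases N_def)
  also have "\<dots> = (\<Sum>w\<in>UNIV. \<Sum>u\<in>S. if adj u w then 1 else 0)"
    by (rule sum.swap)
  also have "\<dots> = (\<Sum>w\<in>UNIV. card (N w \<inter> S))"
    by (intro sum.cong) (auto simp: sum.If_cases intro!: arg_cong[where f=card] dest: sym)
  finally show ?thesis .
qed

text \<open>Over the set \<open>R\<close> of non-neighbours of v,
  \<open>card (N w) + card (N w \<inter> N v)\<close> sums to at most \<open>4 * card R\<close> by
  the size of the graph, yet each term is at least 3 + 1. Hence every term is exactly 4.\<close>

lemma nonneighbour_of_cubic_vertex:
  assumes min3: "\<And>u. 3 \<le> card (N u)" and v: "card (N v) = 3"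
    and r: "r \<noteq> v" "\<not> adj v r"
  shows "card (N r) = 3 \<and> card (N r \<inter> N v) = 1"
proof -
  define R where "R = - insert v (N v)"
  have split: "UNIV = insert v (N v \<union> R)" and dj: "v \<notin> N v \<union> R" "N v \<inter> R = {}"
    using irr by (auto simp: R_def)
  have split_sum: "(\<Sum>u\<in>UNIV. f u) = f v + (\<Sum>u\<in>N v. f u) + (\<Sum>u\<in>R. f u)" for f :: "'v \<Rightarrow> nat"
    unfolding split using dj by (simp add: sum.union_disjoint)
  have cardR: "CARD('v) = 4 + card R"
    using split_sum[of "\<lambda>_. 1"] v by simp
  \<comment> \<open>The 3 comes from v itself; edges inside \<open>N v\<close> are
    discarded.\<close>
  have "3 + (\<Sum>w\<in>R. card (N w \<inter> N v)) \<le> (\<Sum>u\<in>N v. card (N u))"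
    unfolding adj_double_count split_sum using v by simp
  then have le: "(\<Sum>w\<in>R. card (N w) + card (N w \<inter> N v)) \<le> (\<Sum>w\<in>R. 4)"
    using sum_deg split_sum[of "\<lambda>u. card (N u)"] cardR v by (simp add: sum.distrib)
  have one: "1 \<le> card (N w \<inter> N v)" if "w \<in> R" for w
  proof -
    have "\<exists>t. adj v t \<and> adj t w" using that diam[of v w] by (auto simp: R_def)
    then have "N w \<inter> N v \<noteq> {}" using sym by (auto simp: disjoint_iff)
    then show ?thesis by (simp add: Suc_le_eq card_gt_0_iff)
  qed
  have four: "4 \<le> card (N w) + card (N w \<inter> N v)" if "w \<in> R" for w
    using one[OF that] min3[of w] by simp
  have rR: "r \<in> R" using r by (auto simp: R_def)
  have "(\<Sum>w\<in>R. card (N w) + card (N w \<inter> N v)) = (\<Sum>w\<in>R. 4)"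
    by (rule antisym[OF le sum_mono]) (rule four)
  then have "card (N r) + card (N r \<inter> N v) = 4"
    using sum_mono_inv[of "\<lambda>_. 4" R "\<lambda>w. card (N w) + card (N w \<inter> N v)" r] four rR by simp
  then show ?thesis using one[OF rR] min3[of r] by simp
qed

text \<open>A vertex of degree other than 3 is adjacent to all vertices of degree 3. So a non-cubic
  u and a non-neighbour b of it, again non-cubic, are two common neighbours of the non-adjacent
  cubic vertices v and r, where only one is allowed.\<close>

lemma cubic:
  assumes min3: "\<And>u. 3 \<le> card (N u)"
  shows "card (N u) = 3"
proof (rule ccontr)
  assume u: "card (N u) \<noteq> 3"
  obtain v where v: "card (N v) = 3" using exists_deg_le_3 min3 by (meson antisym)
  note nonadj = nonneighbour_of_cubic_vertex[OF min3]
  have adj_cubic: "adj w y" if "card (N y) = 3" "card (N w) \<noteq> 3" for w y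
    using nonadj[of y w] that sym by blast
  obtain r where r: "r \<noteq> v" "\<not> adj v r" using nodom by blast
  have r3: "card (N r) = 3" "card (N r \<inter> N v) = 1" using nonadj[OF v r] by auto
  obtain b where b: "b \<noteq> u" "\<not> adj u b" using nodom by blast
  have b3: "card (N b) \<noteq> 3" using adj_cubic[OF _ u] b by blast
  have "{u, b} \<subseteq> N r \<inter> N v"
    using adj_cubic[OF v u] adj_cubic[OF v b3] adj_cubic[OF r3(1) u] adj_cubic[OF r3(1) b3] sym by auto
  then have "card {u, b} \<le> 1" using r3(2) by (metis card_mono finite)
  then show False using b by simp
qed

section \<open>Oriented edges and vertices of degree 2\<close>

text \<open>\<open>S\<close> picks at most one direction of each edge. Reaching the bound means that
  every edge has been picked, which turns counting into structure.\<close>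

lemma card_le_oriented:
  assumes sub: "\<And>u w. (u, w) \<in> S \<Longrightarrow> adj u w" and anti: "\<And>u w. (u, w) \<in> S \<Longrightarrow> (w, u) \<notin> S"
  shows "card S + 5 \<le> 2 * CARD('v)"
    and "card S + 5 = 2 * CARD('v) \<Longrightarrow> adj u w \<Longrightarrow> (u, w) \<in> S \<or> (w, u) \<in> S"
proof -
  have "S \<inter> S\<inverse> = {}" using anti by auto
  then have c: "card (S \<union> S\<inverse>) = 2 * card S"
    by (simp add: card_Un_disjoint card_inverse)
  have s: "S \<union> S\<inverse> \<subseteq> {(u, w). adj u w}" using sub sym by auto
  have "card (S \<union> S\<inverse>) \<le> card {(u, w). adj u w}" using s by (intro card_mono) auto
  then show "card S + 5 \<le> 2 * CARD('v)" using size c by simp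
  assume "card S + 5 = 2 * CARD('v)" and uw: "adj u w"
  then have "S \<union> S\<inverse> = {(u, w). adj u w}" using size c s by (intro card_subset_eq) auto
  then show "(u, w) \<in> S \<or> (w, u) \<in> S" using uw by auto
qed

text \<open>Otherwise each vertex of \<open>R\<close> has degree at least 3, or degree at least 2
  and both a and b as neighbours. Degree plus the number of neighbours among a, b is then at least 4
  on \<open>R\<close>, and the degree sum is at least 4r - 8, exceeding 4r - 10.\<close>

lemma leaf_exists:
  assumes v: "N v = {a, b}" "a \<noteq> b"
  shows "\<exists>x. x \<notin> {v, a, b} \<and> card (N x) = 2 \<and> (adj x a \<longleftrightarrow> \<not> adj x b)"
proof (rule ccontr)
  assume none: "\<not> ?thesis"
  define R where "R = - {v, a, b}"
  have vab: "adj v a" "adj v b" "v \<noteq> a" "v \<noteq> b" using v irr by (auto simp: set_eq_iff)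
  have split: "UNIV = insert v (insert a (insert b R))" by (auto simp: R_def)
  have split_sum: "(\<Sum>u\<in>UNIV. f u) = f v + f a + f b + (\<Sum>u\<in>R. f u)" for f :: "'v \<Rightarrow> nat"
    unfolding split using vab v by (simp add: R_def)
  have cardR: "CARD('v) = 3 + card R" using split_sum[of "\<lambda>_. 1"] by simp
  have deg_ge: "1 + (\<Sum>u\<in>R. of_bool (adj u c)) \<le> card (N c)" if "adj c v" for c
  proof -
    have "insert v {u \<in> R. adj u c} \<subseteq> N c" using that sym by auto
    then have "card (insert v {u \<in> R. adj u c}) \<le> card (N c)" by (intro card_mono) auto
    then show ?thesis by (simp add: R_def of_bool_def sum.If_cases Int_def)
  qed
  have "(\<Sum>u\<in>R. 4) \<le> (\<Sum>u\<in>R. card (N u) + of_bool (adj u a) + of_bool (adj u b))"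
  proof (rule sum_mono)
    fix u assume "u \<in> R"
    then have u: "u \<notin> {v, a, b}" by (simp add: R_def)
    have "\<not> adj v u" using u v by (auto simp: set_eq_iff)
    then obtain t where "adj v t" "adj t u" using diam[of v u] u by auto
    then have "adj u a \<or> adj u b" using v sym by (auto simp: set_eq_iff)
    then show "4 \<le> card (N u) + of_bool (adj u a) + of_bool (adj u b)"
      using none u deg_ge_2[of u] order_le_less[of 2 "card (N u)"]
      by (cases "adj u a"; cases "adj u b") auto
  qed
  moreover have "card (N v) = 2" using v by simp
  ultimately show False
    using sum_deg split_sum[of "\<lambda>u. card (N u)"] cardR deg_ge[of a] deg_ge[of b] vab sym
    by (simp add: sum.distrib)
qed

end

section \<open>Two vertices of degree 2 and the induced orientations\<close>

locale diam2_leaf = diam2_graph adj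
  for adj :: "'v::finite \<Rightarrow> 'v \<Rightarrow> bool" +
  fixes v a b x z :: 'v
  assumes Nv: "N v = {a, b}" and ab: "a \<noteq> b"
    and x: "x \<notin> {v, a, b}" "\<not> adj x b" and Nx: "N x = {a, z}" and az: "z \<noteq> a"
begin

lemma adj_v: "adj v u \<longleftrightarrow> u = a \<or> u = b" and adj_x: "adj x u \<longleftrightarrow> u = a \<or> u = z"
  using Nv Nx by (auto simp: set_eq_iff)

lemma distinct: "v \<noteq> a" "v \<noteq> b" "x \<noteq> v" "x \<noteq> a" "x \<noteq> b" "z \<noteq> v" "z \<noteq> a" "z \<noteq> b" "z \<noteq> x"
  using x az adj_v[of x] adj_v[of v] adj_x[of z] irr sym by auto

lemma adj_a_or_b: "u \<notin> {a, b} \<Longrightarrow> adj u a \<or> adj u b"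
  using diam[of v u] adj_v sym by (metis insertCI)

lemma adj_z: "\<not> adj u a \<Longrightarrow> u \<notin> {a, b, z} \<Longrightarrow> adj u z"
  using diam[of x u] adj_x sym by (metis insertCI)

text \<open>
  Each vertex outside \<open>{a, b, z}\<close> points to two neighbours and \<open>z\<close> to one. Admissibility of \<open>g\<close>
  ensures that no edge is chosen from both ends, so that \<open>2r - 5\<close> distinct edges are counted.
\<close>

definition orient :: "('v \<Rightarrow> 'v) \<Rightarrow> ('v \<times> 'v) set" where
  "orient g = (\<lambda>u. (u, if adj u a then a else b)) ` (- {a, b}) \<union>
     (\<lambda>u. (u, if adj u a then if adj u b then b else g u else z)) ` (- {a, b, z})"

definition admissible :: "('v \<Rightarrow> 'v) \<Rightarrow> bool" where
  "admissible g \<longleftrightarrow> (\<forall>u. u \<notin> {a, b, z} \<and> adj u a \<and> \<not> adj u b \<longrightarrow>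
     adj u (g u) \<and> g u \<notin> {a, b} \<and> (g u \<noteq> z \<and> adj (g u) a \<and> \<not> adj (g u) b \<longrightarrow> g (g u) \<noteq> u))"

lemma orient_iff:
  "(u, w) \<in> orient g \<longleftrightarrow> u \<notin> {a, b} \<and>
     (w = (if adj u a then a else b) \<or>
      u \<noteq> z \<and> w = (if adj u a then if adj u b then b else g u else z))"
  by (auto simp: orient_def)

text \<open>Arcs staying outside {a, b} end in \<open>g p\<close> or in z, and z sends none of them.
  So an edge chosen from both ends would be a 2-cycle of \<open>g\<close>, which admissibility
  excludes.\<close>

lemma orient:
  assumes g: "admissible g"
  shows "(u, w) \<in> orient g \<Longrightarrow> adj u w" and "(u, w) \<in> orient g \<Longrightarrow> (w, u) \<notin> orient g"
    and "card (orient g) + 5 = 2 * CARD('v)"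
proof -
  show "adj u w" if "(u, w) \<in> orient g"
    using that g adj_a_or_b[of u] adj_z[of u]
    by (auto simp: orient_iff admissible_def split: if_splits)
  show "(w, u) \<notin> orient g" if uw: "(u, w) \<in> orient g"
  proof
    assume wu: "(w, u) \<in> orient g"
    have inner: "p \<noteq> z \<and> (adj p a \<and> \<not> adj p b \<and> q = g p \<or> \<not> adj p a \<and> q = z)"
      if "(p, q) \<in> orient g" "q \<notin> {a, b}" for p q
      using that by (simp add: orient_iff split: if_splits)
    have uw_ab: "u \<notin> {a, b}" "w \<notin> {a, b}" using uw wu by (simp_all add: orient_iff)
    have u: "u \<noteq> z" "adj u a" "\<not> adj u b" "w = g u" and w: "w \<noteq> z" "adj w a" "\<not> adj w b" "u = g w"
      using inner[OF uw uw_ab(2)] inner[OF wu uw_ab(1)] by metis+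
    then have "g (g u) \<noteq> u"
      using g uw_ab(1) unfolding admissible_def by blast
    then show False using u(4) w(4) by metis
  qed
  let ?P = "(\<lambda>u. (u, if adj u a then a else b)) ` (- {a, b})"
  let ?Q = "(\<lambda>u. (u, if adj u a then if adj u b then b else g u else z)) ` (- {a, b, z})"
  \<comment> \<open>First and second arcs of a vertex differ, so the r - 2 arcs of \<open>?P\<close>
    and the r - 3 arcs of \<open>?Q\<close> add up to 2r - 5.\<close>
  have "g u \<noteq> a" if "u \<notin> {a, b, z}" "adj u a" "\<not> adj u b" for u
    using g that unfolding admissible_def by blast
  then have "?P \<inter> ?Q = {}" using ab distinct by (auto split: if_splits) metis
  then have "card (orient g) = card ?P + card ?Q" unfolding orient_def by (intro card_Un_disjoint) auto
  moreover have "card ?P = CARD('v) - 2"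
    using ab by (subst card_image) (auto simp: inj_on_def Compl_eq_Diff_UNIV card_Diff_subset)
  moreover have "card ?Q = CARD('v) - 3"
    using ab distinct by (subst card_image) (auto simp: inj_on_def Compl_eq_Diff_UNIV card_Diff_subset)
  moreover have "card {a, b, z} \<le> CARD('v)" by (intro card_mono) auto
  then have "3 \<le> CARD('v)" using ab distinct by simp
  ultimately show "card (orient g) + 5 = 2 * CARD('v)" by simp
qed

lemma adj_orient:
  assumes "admissible g" "adj u w"
  shows "(u, w) \<in> orient g \<or> (w, u) \<in> orient g"
  using card_le_oriented(2)[of "orient g"] orient[OF assms(1)] assms(2) by blast

section \<open>Structure forced by the orientations\<close>

text \<open>No arc starts at a or b, so an edge ab would be missed by any admissible orientation.
  One is built by steering second arcs towards a non-neighbour y of a.\<close>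

lemma not_adj_a_b: "\<not> adj a b"
proof
  assume adj: "adj a b"
  obtain y where y: "y \<noteq> a" "\<not> adj a y" using nodom by blast
  have yb: "y \<noteq> b" "y \<noteq> v" using adj y adj_v sym by blast+
  define g where "g u = (if adj u y then y else SOME t. adj u t \<and> adj t y)" for u
  have "admissible g" unfolding admissible_def
  proof (intro allI impI)
    fix u assume u: "u \<notin> {a, b, z} \<and> adj u a \<and> \<not> adj u b"
    have uy: "u \<noteq> y" using u y sym by blast
    show "adj u (g u) \<and> g u \<notin> {a, b} \<and> (g u \<noteq> z \<and> adj (g u) a \<and> \<not> adj (g u) b \<longrightarrow> g (g u) \<noteq> u)"
    proof (cases "adj u y")
      case True
      then show ?thesis using y yb sym by (auto simp: g_def)
    next
      case False
      then have "\<exists>t. adj u t \<and> adj t y" using diam[of u y] uy by blast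
      then have t: "adj u (SOME t. adj u t \<and> adj t y) \<and> adj (SOME t. adj u t \<and> adj t y) y"
        by (rule someI_ex)
      \<comment> \<open>The chosen common neighbour is adjacent to y, so applying \<open>g\<close>
        again leads to y and never back to u.\<close>
      then have "g (g u) = y" using False by (simp add: g_def)
      then show ?thesis using t False u y uy by (auto simp: g_def)
    qed
  qed
  then show False using adj_orient[OF _ adj] by (auto simp: orient_iff)
qed

lemma adj_z_b: "adj z b"
  using diam[of x b] adj_x not_adj_a_b distinct x by metis

text \<open>Once \<open>a\<close> and \<open>b\<close> are known to be non-adjacent, second edges can be directed towards \<open>b\<close>.\<close>

definition other :: "'v \<Rightarrow> 'v" where
  "other u = (SOME t. adj u t \<and> adj t b)"

lemma other: "u \<noteq> b \<Longrightarrow> \<not> adj u b \<Longrightarrow> adj u (other u) \<and> adj (other u) b"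
  unfolding other_def using someI_ex[OF diam[of u b]] by blast

text \<open>Since \<open>other u\<close> is adjacent to b, the condition against 2-cycles is
  vacuous.\<close>

lemma admissible_other: "admissible other"
  unfolding admissible_def
proof (intro allI impI)
  fix u assume "u \<notin> {a, b, z} \<and> adj u a \<and> \<not> adj u b"
  then have "adj u (other u) \<and> adj (other u) b" using other by blast
  then show "adj u (other u) \<and> other u \<notin> {a, b} \<and>
      (other u \<noteq> z \<and> adj (other u) a \<and> \<not> adj (other u) b \<longrightarrow> other (other u) \<noteq> u)"
    using irr not_adj_a_b by auto
qed

lemmas adj_cases = adj_orient[OF admissible_other, unfolded orient_iff]

text \<open>If z were adjacent to a, its only arc would go to a and the edge zb would be
  missed.\<close>

lemma not_adj_z_a: "\<not> adj z a"
proof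
  assume "adj z a"
  then show False using adj_cases[OF adj_z_b] ab distinct by auto
qed

text \<open>Such a u sends arcs only to a and \<open>other u\<close>, and receives none: targets of
  arcs are a, b, z or some \<open>other w\<close>, and the last two are adjacent to b.\<close>

lemma nbr_only_a:
  assumes u: "adj u a" "\<not> adj u b" "u \<noteq> b"
  shows "adj u w \<longleftrightarrow> w = a \<or> w = other u"
proof
  have ua: "u \<noteq> a" "u \<noteq> z" using u irr adj_z_b by auto
  assume "adj u w"
  then show "w = a \<or> w = other u"
    using adj_cases[of u w] u ua other[of w] by (auto split: if_splits)
next
  assume "w = a \<or> w = other u"
  then show "adj u w" using u other by auto
qed

text \<open>If \<open>other u\<close> were adjacent to a, a path of length 2 from u to z would have
  to use the edge from \<open>other u\<close> to z. That edge carries no arc: \<open>other u\<close>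
  points to a and b, and z to b.\<close>

lemma other_only_b:
  assumes u: "adj u a" "\<not> adj u b" "u \<noteq> b"
  shows "\<not> adj (other u) a"
proof
  assume o: "adj (other u) a"
  have ob: "adj (other u) b" using other u by blast
  have "u \<noteq> z" using u adj_z_b by auto
  have "\<not> adj u z" using nbr_only_a[OF u] o not_adj_z_a distinct by auto
  then obtain t where t: "adj u t" "adj t z" using diam[of u z] \<open>u \<noteq> z\<close> by blast
  then have "adj (other u) z" using nbr_only_a[OF u, of t] not_adj_z_a sym[of a z] by auto
  then show False using adj_cases[of "other u" z] o ob irr not_adj_z_a adj_z_b distinct
    by (auto split: if_splits)
qed

text \<open>These vertices are the copies of v: their arcs go to a and b, and an incoming arc would
  make them some \<open>other w\<close>, which is not adjacent to a.\<close>

lemma nbr_both: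
  assumes u: "adj u a" "adj u b"
  shows "adj u w \<longleftrightarrow> w = a \<or> w = b"
proof
  assume w: "adj u w"
  have "u \<notin> {a, b, z}" using u irr not_adj_z_a by auto
  then show "w = a \<or> w = b"
    using adj_cases[OF w] u other[of w] other_only_b[of w] by (auto split: if_splits)
qed (use u in auto)

lemma only_b_other:
  assumes y: "adj y b" "\<not> adj y a" "y \<noteq> a"
  shows "\<exists>u. adj u a \<and> \<not> adj u b \<and> u \<noteq> b \<and> other u = y"
proof -
  obtain u where u: "adj y u" "adj u a" using diam[of y a] y by blast
  have ub: "u \<noteq> b" using u not_adj_a_b sym by blast
  have nu: "\<not> adj u b"
  proof
    assume "adj u b"
    then have "y = a \<or> y = b" using nbr_both[of u y] u sym by blast
    then show False using y irr by blast
  qed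
  then have "y = a \<or> y = other u" using nbr_only_a[of u y] u ub sym by blast
  then show ?thesis using u ub nu y by blast
qed

text \<open>Vertices of this kind send arcs only to b and z.\<close>

lemma nbr_only_b:
  assumes y: "adj y b" "\<not> adj y a" "y \<noteq> a" and y': "adj y' b" "\<not> adj y' a" "y' \<noteq> a"
    and adj: "adj y y'"
  shows "y = z \<or> y' = z"
proof -
  have "y \<noteq> b" "y' \<noteq> b" using y y' irr by auto
  then show ?thesis using adj_cases[OF adj] y y' by (auto split: if_splits)
qed

text \<open>The only neighbours of u are a and \<open>other u\<close>, and a is not adjacent to y,
  so the path from u to y runs through \<open>other u\<close>.\<close>

lemma pairwise_adj_only_b:
  assumes u: "adj u a" "\<not> adj u b" "u \<noteq> b" and y: "adj y b" "\<not> adj y a" "y \<noteq> a" "y \<noteq> other u"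
  shows "adj (other u) y"
proof -
  have "\<not> adj u y" "u \<noteq> y" using nbr_only_a[OF u] u y by auto
  then obtain t where "adj u t" "adj t y" using diam[of u y] by blast
  then show ?thesis using nbr_only_a[OF u, of t] y(2) sym[of a y] by auto
qed

section \<open>Weights with constant neighbourhood sums\<close>

lemma vertex_cases:
  obtains "u = a" | "u = b" | "adj u a" "adj u b" | "adj u a" "\<not> adj u b" "u \<noteq> b"
    | "adj u b" "\<not> adj u a" "u \<noteq> a"
  using adj_a_or_b[of u] by blast

lemma adj_to_v: "adj u v \<longleftrightarrow> u = a \<or> u = b" and adj_to_x: "adj u x \<longleftrightarrow> u = a \<or> u = z"
  using adj_v adj_x adj_commute by blast+

lemma adj_special:
  "\<not> adj b a" "\<not> adj a z" "adj b z"
  using not_adj_a_b not_adj_z_a adj_z_b adj_commute by blast+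

lemmas adj_simps = adj_v adj_x adj_to_v adj_to_x adj_special not_adj_a_b not_adj_z_a adj_z_b irr
  distinct ab

text \<open>One representative of each class of twins is weighted. The first case is the 5-cycle v,
  a, x, z, b. The second is the triangle b, y, z joined to a through v, x', x; there a has weight 2
  because each middle vertex sees only a and one corner.\<close>

lemma weights:
  "(\<forall>u. of_bool (adj u v) + of_bool (adj u a) + of_bool (adj u b) + of_bool (adj u x)
      + of_bool (adj u z) = (2::real)) \<or>
   (\<exists>x' y. \<forall>u. of_bool (adj u v) + of_bool (adj u x) + of_bool (adj u x') + of_bool (adj u b)
      + of_bool (adj u y) + of_bool (adj u z) + 2 * of_bool (adj u a) = (3::real))"
proof (cases "\<forall>u. adj u a \<and> \<not> adj u b \<and> u \<noteq> b \<longrightarrow> other u = z")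
  case True
  have onlyb: "y = z" if "adj y b" "\<not> adj y a" "y \<noteq> a" for y
    using only_b_other[OF that] True by metis
  have "of_bool (adj u v) + of_bool (adj u a) + of_bool (adj u b) + of_bool (adj u x)
      + of_bool (adj u z) = (2::real)" for u
  proof (cases rule: vertex_cases[of u])
    case 3
    show ?thesis
      using distinct ab by (simp add: nbr_both[OF 3] eq_commute)
  next
    case 4
    have "other u = z" using True 4 by metis
    then show ?thesis
      using distinct ab by (simp add: nbr_only_a[OF 4] eq_commute)
  next
    case 5
    then have "u = z" using onlyb by metis
    then show ?thesis by (simp add: adj_simps)
  qed (simp_all add: adj_simps ab[symmetric] distinct[symmetric])
  then show ?thesis by blast
next
  case False
  then obtain x' where x': "adj x' a" "\<not> adj x' b" "x' \<noteq> b" "other x' \<noteq> z" by blast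
  define y where "y = other x'"
  have y: "adj y b" "\<not> adj y a" "y \<noteq> z"
    using other[OF x'(3,2)] other_only_b[OF x'(1-3)] x' by (simp_all add: y_def)
  have ya: "y \<noteq> a" using y(1) not_adj_a_b by metis
  note z = adj_z_b not_adj_z_a distinct(7)
  \<comment> \<open>A third such w would be adjacent to y, and an edge between two of these vertices
    must involve z.\<close>
  have onlyb: "w = y \<or> w = z" if w: "adj w b" "\<not> adj w a" "w \<noteq> a" for w
    using pairwise_adj_only_b[OF x'(1-3) w] nbr_only_b[OF y(1,2) ya w] y(3) unfolding y_def by metis
  have yz: "adj y z" using pairwise_adj_only_b[OF x'(1-3) z] x'(4) unfolding y_def by metis
  have adj_x': "adj x' u \<longleftrightarrow> u = a \<or> u = y" for u
    unfolding y_def by (rule nbr_only_a[OF x'(1-3)])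
  have adj_to_x': "adj u x' \<longleftrightarrow> u = a \<or> u = y" for u
    unfolding adj_commute[of u] by (rule adj_x')
  have y_flip: "adj b y" "\<not> adj a y" "adj z y"
    using y yz adj_commute by metis+
  have ne: "y \<noteq> v" "y \<noteq> b" "y \<noteq> x" "x' \<noteq> v" "x' \<noteq> a"
    using y x' adj_simps by metis+
  note new_simps = adj_x' adj_to_x' y ya yz y_flip ne x'(3) y(3)[symmetric]
  have "of_bool (adj u v) + of_bool (adj u x) + of_bool (adj u x') + of_bool (adj u b)
      + of_bool (adj u y) + of_bool (adj u z) + 2 * of_bool (adj u a) = (3::real)" for u
  proof (cases rule: vertex_cases[of u])
    case 3
    show ?thesis
      using distinct ab ne ya x'(3) by (simp add: nbr_both[OF 3] eq_commute)
  next
    case 4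
    \<comment> \<open>So u is a copy of x' or of x, according to \<open>other u\<close>.\<close>
    have "u \<noteq> a" "u \<noteq> z" "other u = y \<or> other u = z"
      using onlyb[of "other u"] other[OF 4(3,2)] other_only_b[OF 4] 4 adj_simps by metis+
    then show ?thesis
    proof (elim disjE)
      assume o: "other u = y"
      then have "u \<noteq> y" "\<not> adj u x'" using 4(1) y(2) \<open>u \<noteq> a\<close> adj_to_x' by metis+
      then show ?thesis using o distinct ab new_simps by (simp add: nbr_only_a[OF 4] eq_commute)
    next
      assume o: "other u = z"
      then have "u \<noteq> y" "\<not> adj u x'" using 4(1) y(2) \<open>u \<noteq> a\<close> adj_to_x' by metis+
      then show ?thesis using o distinct ab new_simps by (simp add: nbr_only_a[OF 4] eq_commute)
    qed
  next
    case 5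
    then show ?thesis using onlyb[OF 5]
      by (elim disjE) (simp_all add: adj_simps new_simps)
  qed (simp_all add: adj_simps new_simps ab[symmetric] distinct[symmetric] ya[symmetric] ne[symmetric])
  then show ?thesis by blast
qed

end

section \<open>The all-ones vector in the row space\<close>

context diam2_graph
begin

lemma one_in_span: "1 \<in> span (rows (adjacency_matrix adj))"
proof -
  let ?r = "\<lambda>u. row u (adjacency_matrix adj)"
  let ?S = "span (rows (adjacency_matrix adj))"
  have r_nth [simp]: "?r u $ w = of_bool (adj w u)" for u w
    using adj_commute[of u w] by (simp add: row_def adjacency_matrix_def)
  have r: "?r u \<in> ?S" for u
    by (intro span_base) (auto simp: rows_def)
  show ?thesis
  proof (cases "\<forall>u. 3 \<le> card (N u)")
    case True
    have "(\<Sum>u\<in>UNIV. ?r u) $ w = 3" for w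
    proof -
      have "(\<Sum>u\<in>UNIV. ?r u) $ w = (\<Sum>u\<in>UNIV. of_bool (adj w u))"
        by simp
      also have "\<dots> = real (card (N w))" by (simp add: of_bool_def sum.If_cases N_def)
      finally show ?thesis using cubic[of w] True by simp
    qed
    then have "1 = (1/3) *\<^sub>R (\<Sum>u\<in>UNIV. ?r u)" by (simp add: vec_eq_iff)
    also have "\<dots> \<in> ?S" by (intro span_scale span_sum r)
    finally show ?thesis .
  next
    case False
    then obtain v where "card (N v) < 3" using not_le by blast
    then have "card (N v) = 2" using deg_ge_2[of v] by simp
    then obtain a b where v: "N v = {a, b}" "a \<noteq> b" by (auto simp: card_2_iff)
    obtain x where x: "x \<notin> {v, a, b}" "card (N x) = 2" "adj x a \<longleftrightarrow> \<not> adj x b"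
      using leaf_exists[OF v] by blast
    \<comment> \<open>Swap a and b if needed, so that x is adjacent to the first one.\<close>
    obtain a' b' where ab: "N v = {a', b'}" "a' \<noteq> b'" "x \<notin> {v, a', b'}" "adj x a'" "\<not> adj x b'"
      using v x by (metis insert_commute)
    obtain z where z: "N x = {a', z}" "z \<noteq> a'"
    proof -
      obtain p q where "N x = {p, q}" "p \<noteq> q" using x(2) by (auto simp: card_2_iff)
      moreover have "a' \<in> N x" using ab(4) by simp
      ultimately show ?thesis using that by auto
    qed
    interpret diam2_leaf adj v a' b' x z
      by unfold_locales (use ab z in auto)
    from weights show ?thesis
    proof (elim disjE exE)
      assume "\<forall>u. of_bool (adj u v) + of_bool (adj u a') + of_bool (adj u b') + of_bool (adj u x)
          + of_bool (adj u z) = (2::real)"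
      then have "1 = (1/2) *\<^sub>R (?r v + ?r a' + ?r b' + ?r x + ?r z)"
        by (simp add: vec_eq_iff)
      also have "\<dots> \<in> ?S" by (intro span_scale span_add r)
      finally show ?thesis .
    next
      fix x' y
      assume "\<forall>u. of_bool (adj u v) + of_bool (adj u x) + of_bool (adj u x') + of_bool (adj u b')
          + of_bool (adj u y) + of_bool (adj u z) + 2 * of_bool (adj u a') = (3::real)"
      then have "1 = (1/3) *\<^sub>R (?r v + ?r x + ?r x' + ?r b' + ?r y + ?r z + 2 *\<^sub>R ?r a')"
        by (simp add: vec_eq_iff)
      also have "\<dots> \<in> ?S" by (intro span_scale span_add r)
      finally show ?thesis .
    qed
  qed
qed

end

section \<open>Transfer from the graph-theoretic definitions\<close>

lemma card_adj_pairs: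
  fixes adj :: "'v::finite \<Rightarrow> 'v \<Rightarrow> bool"
  assumes "simple_graph adj"
  shows "card {(u, w). adj u w} = 2 * card (edges adj)"
proof -
  let ?D = "{(u, w). adj u w}" and ?f = "\<lambda>(u, w). {u, w}"
  have sym: "adj u w \<Longrightarrow> adj w u" and irr: "\<not> adj u u" for u w
    using assms by (auto simp: simple_graph_def symp_def irreflp_def)
  have img: "?f ` ?D = edges adj" by (auto simp: edges_def)
  have fibre: "card {p \<in> ?D. ?f p = e} = 2" if e_edge: "e \<in> edges adj" for e
  proof -
    obtain u w where e: "e = {u, w}" "adj u w" using e_edge unfolding edges_def by blast
    then have "{p \<in> ?D. ?f p = e} = {(u, w), (w, u)}" using sym by (auto simp: doubleton_eq_iff)
    moreover have "u \<noteq> w" using e irr by blast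
    ultimately show ?thesis by simp
  qed
  have "card ?D = (\<Sum>e\<in>?f ` ?D. card {p \<in> ?D. ?f p = e})"
    using sum.image_gen[of ?D "\<lambda>_. 1::nat" ?f] by simp
  then show ?thesis unfolding img using fibre by simp
qed

lemma common_neighbour_of_diameter_le_2:
  assumes "graph_diameter adj \<le> 2" "u \<noteq> w" "\<not> adj u w"
  shows "\<exists>t. adj u t \<and> adj t w"
proof -
  have "graph_dist adj u w \<le> graph_diameter adj"
    unfolding graph_diameter_def by (meson SUP_upper UNIV_I order_trans)
  then have "graph_dist adj u w < enat 3"
    using assms(1) by (metis enat_ord_simps(2) eval_nat_numeral(3) lessI numeral_eq_enat order_le_less_trans)
  then obtain n where n: "(adj ^^ n) u w" "n < 3"
    unfolding graph_dist_def by (auto simp: INF_less_iff)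
  then have "n = 0 \<or> n = 1 \<or> n = 2" by auto
  then show ?thesis using n assms by (auto simp: numeral_2_eq_2)
qed

theorem theorem3p3:
  fixes adj :: "'v::finite \<Rightarrow> 'v \<Rightarrow> bool" and r s :: nat
  assumes "simple_graph adj"
    and "graph_diameter adj = 2"
    and "r = CARD('v)"
    and "s = card (edges adj)"
    and "\<nexists>v. dominating_vertex adj v"
    and "int s = 2 * int r - 5"
  shows "\<exists>x :: real ^ 'v. x \<noteq> 0 \<and> (\<forall>i. x $ i \<in> {0, 1}) \<and>
           x \<in> span (rows (adjacency_matrix adj)) \<and> x \<notin> rows (adjacency_matrix adj)"
proof -
  have irr: "\<not> adj u u" for u using assms(1) by (auto simp: simple_graph_def irreflp_def)
  interpret diam2_graph adj
  proof
    show "adj w u" if "adj u w" for u w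
      using assms(1) that by (auto simp: simple_graph_def symp_def)
    show "\<exists>t. adj u t \<and> adj t w" if "u \<noteq> w" "\<not> adj u w" for u w
      using common_neighbour_of_diameter_le_2[of adj u w] assms(2) that by simp
    show "\<exists>w. w \<noteq> u \<and> \<not> adj u w" for u
      using assms(5) by (auto simp: dominating_vertex_def)
    show "card {(u, w). adj u w} + 10 = 4 * CARD('v)"
      using card_adj_pairs[OF assms(1)] assms by linarith
  qed (rule irr)
  have "(1 :: real ^ 'v) \<notin> rows (adjacency_matrix adj)"
  proof
    assume "(1 :: real ^ 'v) \<in> rows (adjacency_matrix adj)"
    then obtain i where "(1 :: real ^ 'v) = row i (adjacency_matrix adj)" by (auto simp: rows_def)
    then have "(1 :: real ^ 'v) $ i = row i (adjacency_matrix adj) $ i" by simp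
    then show False using irr by (simp add: row_def adjacency_matrix_def)
  qed
  then show ?thesis using one_in_span by (intro exI[of _ 1]) simp
qed

end
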